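(* Let $G=\langle V,A\rangle$ be a finite directed graph with $n$ vertices such that $N^+(v)=\{u\mid vu\in A\}$ is nonempty for every $v\in V$. Let $N^+[v]=N^+(v)\cup\{v\}$. Let $L:V\to\{1,\dots,n\}$ be a bijective labelling chosen uniformly at random among all $n!$ labellings, and for $v\in V$ let $r_L(v)=\operatorname{argmin}_{w\in N^+[v]}L(w)$. Then $\mathbb{E}\bigl(|\{r_L(v)\mid v\in V\}|\bigr)\le \tfrac23 n$. Moreover, this bound is tight: for the directed 3-cycle equality holds. *)

theory Defs
  imports "HOL-Probability.Probability" "HOL-Combinatorics.Permutations" "Graph_Theory.Pair_Digraph"
begin

definition out_nbhd :: "'a pair_pre_digraph \<Rightarrow> 'a \<Rightarrow> 'a set" where
  "out_nbhd G v = {u. (v, u) \<in> parcs G}"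

definition closed_out_nbhd :: "'a pair_pre_digraph \<Rightarrow> 'a \<Rightarrow> 'a set" where
  "closed_out_nbhd G v = out_nbhd G v \<union> {v}"

text \<open>
  Labellings are total functions in HOL; requiring extensionality outside the vertex set makes
  each bijection \<open>V \<rightarrow> {1..n}\<close> occur exactly once, so that there are \<open>n!\<close> of them.
\<close>

definition labellings :: "'a set \<Rightarrow> ('a \<Rightarrow> nat) set" where
  "labellings V = {L \<in> extensional V. bij_betw L V {1..card V}}"

definition representative :: "'a pair_pre_digraph \<Rightarrow> ('a \<Rightarrow> nat) \<Rightarrow> 'a \<Rightarrow> 'a" where
  "representative G L v = arg_min_on L (closed_out_nbhd G v)"

definition expected_representatives :: "'a pair_pre_digraph \<Rightarrow> real" where
  "expected_representatives G =
     measure_pmf.expectation (pmf_of_set (labellings (pverts G)))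
       (\<lambda>L. real (card {representative G L v | v. v \<in> pverts G}))"

definition directed_3_cycle :: "nat pair_pre_digraph" where
  "directed_3_cycle = \<lparr>pverts = {0, 1, 2}, parcs = {(0, 1), (1, 2), (2, 0)}\<rparr>"

text \<open>The uniform distribution on a finite set is only meaningful if the set is nonempty:\<close>

lemma finite_labellings:
  assumes "finite V"
  shows "finite (labellings V)"
proof (rule finite_subset)
  show "labellings V \<subseteq> V \<rightarrow>\<^sub>E {1..card V}"
    by (auto simp: labellings_def PiE_def bij_betw_def)
  show "finite (V \<rightarrow>\<^sub>E {1..card V})"
    using assms by (intro finite_PiE) auto
qed

lemma labellings_nonempty:
  assumes "finite V"
  shows "labellings V \<noteq> {}"
proof -
  obtain L where "bij_betw L V {1..card V}"
    using assms by (metis finite_same_card_bij finite_atLeastAtMost card_atLeastAtMost diff_Suc_1)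
  hence "bij_betw (restrict L V) V {1..card V}"
    by (simp cong: bij_betw_cong)
  thus ?thesis
    by (auto simp: labellings_def intro: restrict_extensional)
qed

lemma card_labellings:
  assumes "finite V"
  shows "card (labellings V) = fact (card V)"
proof -
  obtain L where L: "bij_betw L V {1..card V}"
    using labellings_nonempty[OF assms] by (auto simp: labellings_def)
  have "bij_betw (\<lambda>p. restrict (L \<circ> p) V) {p. p permutes V} (labellings V)"
    unfolding bij_betw_def
  proof (intro conjI inj_onI equalityI subsetI)
    fix p q
    assume p: "p \<in> {p. p permutes V}" and q: "q \<in> {p. p permutes V}"
      and eq: "restrict (L \<circ> p) V = restrict (L \<circ> q) V"
    show "p = q"
    proof
      fix x
      show "p x = q x"
      proof (cases "x \<in> V")
        case True
        then have "L (p x) = L (q x)"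
          using fun_cong[OF eq, of x] by simp
        with True p q L show ?thesis
          by (auto simp: bij_betw_def permutes_in_image dest: inj_onD)
      next
        case False
        with p q show ?thesis by (simp add: permutes_not_in)
      qed
    qed
  next
    fix M
    assume "M \<in> (\<lambda>p. restrict (L \<circ> p) V) ` {p. p permutes V}"
    then obtain p where p: "p permutes V" "M = restrict (L \<circ> p) V"
      by auto
    have "bij_betw (L \<circ> p) V {1..card V}"
      using permutes_imp_bij[OF p(1)] L by (rule bij_betw_trans)
    then show "M \<in> labellings V"
      using p(2) by (simp add: labellings_def cong: bij_betw_cong)
  next
    fix M
    assume M: "M \<in> labellings V"
    define p where "p = (\<lambda>x. if x \<in> V then inv_into V L (M x) else x)"
    have "bij_betw (inv_into V L \<circ> M) V V"
      using M bij_betw_inv_into[OF L] by (auto simp: labellings_def intro: bij_betw_trans)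
    then have "bij_betw p V V"
      by (simp add: p_def cong: bij_betw_cong)
    then have p: "p permutes V"
      by (rule bij_imp_permutes) (simp add: p_def)
    have "M = restrict (L \<circ> p) V"
    proof
      fix x
      show "M x = restrict (L \<circ> p) V x"
      proof (cases "x \<in> V")
        case True
        then have "M x \<in> {1..card V}"
          using M by (auto simp: labellings_def bij_betw_def)
        with True show ?thesis
          by (simp add: p_def bij_betw_inv_into_right[OF L])
      next
        case False
        with M show ?thesis by (simp add: labellings_def extensional_def)
      qed
    qed
    with p show "M \<in> (\<lambda>p. restrict (L \<circ> p) V) ` {p. p permutes V}"
      by blast
  qed
  from bij_betw_same_card[OF this] show ?thesis
    using card_permutations[OF refl assms] by simp
qed

end

theory Submission
  imports Defs
begin

text \<open>
  For a vertex \<open>v\<close> let \<open>X v\<close> be the number of vertices represented by \<open>v\<close>. Then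
  \<open>P (X v = 1) \<le> P (X v = 0)\<close>: if \<open>w\<close> is the only vertex represented by \<open>v\<close>, exchanging the labels
  of \<open>v\<close> and of the second smallest vertex of \<open>N\<^sup>+[w]\<close> gives a labelling in which \<open>v\<close> represents
  nothing, and this exchange is injective. Since \<open>X v + [X v = 1] + 2 [X v = 0] \<ge> 2\<close> and the sum
  of all \<open>X v\<close> is \<open>n\<close>, taking expectations shows that on average at least \<open>n / 3\<close> vertices
  represent nothing.
\<close>

section \<open>Minimisers, labellings and the expectation as an average\<close>

text \<open>Injectivity leaves only one minimiser, so the arbitrary choice in
  \<open>arg_min_on\<close> is determined.\<close>

lemma arg_min_on_eq_iff:
  fixes f :: "'a \<Rightarrow> 'b :: linorder"
  assumes "finite S" "S \<noteq> {}" "inj_on f S"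
  shows "arg_min_on f S = x \<longleftrightarrow> x \<in> S \<and> (\<forall>y\<in>S. f x \<le> f y)"
proof -
  have "arg_min_on f S \<in> S" "\<forall>y\<in>S. f (arg_min_on f S) \<le> f y"
    using arg_min_if_finite[OF assms(1,2), of f] by (auto simp: not_less)
  with assms(3) show ?thesis
    by (metis inj_onD order_antisym)
qed

lemma closed_out_nbhd_self: "v \<in> closed_out_nbhd G v"
  by (simp add: closed_out_nbhd_def)

lemma labellings_inj_on: "L \<in> labellings V \<Longrightarrow> inj_on L V"
  by (simp add: labellings_def bij_betw_def)

lemma labellings_comp_transpose:
  assumes "L \<in> labellings V" "a \<in> V" "b \<in> V"
  shows "L \<circ> Transposition.transpose a b \<in> labellings V"
proof -
  have "bij_betw (L \<circ> Transposition.transpose a b) V {1..card V}"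
    using assms by (intro bij_betw_trans[of _ V V]) (auto simp: labellings_def)
  moreover have "L \<circ> Transposition.transpose a b \<in> extensional V"
    using assms by (auto simp: labellings_def extensional_def Transposition.transpose_def)
  ultimately show ?thesis
    by (simp add: labellings_def)
qed

text \<open>Turns the expectation into a quotient of finite sums, so that the bound becomes a double
  count over labellings and vertices.\<close>

lemma expected_representatives_eq:
  assumes "finite (pverts G)"
  shows "expected_representatives G =
    (\<Sum>L\<in>labellings (pverts G). real (card (representative G L ` pverts G)))
      / card (labellings (pverts G))"
  unfolding expected_representatives_def
  by (simp add: integral_pmf_of_set finite_labellings labellings_nonempty assms Setcompr_eq_image)

section \<open>Counting by representative\<close>

context pair_digraph
begin

lemma closed_out_nbhd_subset: "v \<in> pverts G \<Longrightarrow> closed_out_nbhd G v \<subseteq> pverts G"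
  using in_arcsD2 by (auto simp: closed_out_nbhd_def out_nbhd_def)

lemma representative_eq_iff:
  assumes "L \<in> labellings (pverts G)" "w \<in> pverts G"
  shows "representative G L w = v \<longleftrightarrow>
    v \<in> closed_out_nbhd G w \<and> (\<forall>u\<in>closed_out_nbhd G w. L v \<le> L u)"
proof -
  have "finite (closed_out_nbhd G w)"
    using finite_subset[OF closed_out_nbhd_subset[OF assms(2)]] by simp
  moreover have "inj_on L (closed_out_nbhd G w)"
    by (rule inj_on_subset[OF labellings_inj_on[OF assms(1)] closed_out_nbhd_subset[OF assms(2)]])
  moreover have "closed_out_nbhd G w \<noteq> {}"
    using closed_out_nbhd_self[of w G] by auto
  ultimately show ?thesis
    unfolding representative_def by (intro arg_min_on_eq_iff)
qed

text \<open>Its cardinality is the \<open>X v\<close> of the overview; the set is kept because the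
  exchange needs its sole element.\<close>

definition represented :: "('a \<Rightarrow> nat) \<Rightarrow> 'a \<Rightarrow> 'a set" where
  "represented L v = {w \<in> pverts G. representative G L w = v}"

lemma sum_card_represented:
  assumes "L \<in> labellings (pverts G)"
  shows "(\<Sum>v\<in>pverts G. card (represented L v)) = card (pverts G)"
proof -
  have "representative G L ` pverts G \<subseteq> pverts G"
    using representative_eq_iff[OF assms] closed_out_nbhd_subset by blast
  from sum.group[OF _ _ this, of "\<lambda>_. 1 :: nat"] show ?thesis
    by (simp add: represented_def)
qed

lemma card_representatives:
  assumes "L \<in> labellings (pverts G)"
  shows "card (representative G L ` pverts G) + card {v \<in> pverts G. represented L v = {}}
    = card (pverts G)"
proof -
  have "representative G L ` pverts G \<subseteq> pverts G"
    using representative_eq_iff[OF assms] closed_out_nbhd_subset by blast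
  then have "pverts G = representative G L ` pverts G \<union> {v \<in> pverts G. represented L v = {}}"
    by (auto simp: represented_def)
  moreover have "representative G L ` pverts G \<inter> {v \<in> pverts G. represented L v = {}} = {}"
    by (auto simp: represented_def)
  ultimately show ?thesis
    using card_Un_disjoint[of "representative G L ` pverts G" "{v \<in> pverts G. represented L v = {}}"]
    by simp
qed

section \<open>Exchanging two labels\<close>

text \<open>
  The labelling \<open>K\<close> obtained by exchanging the labels of \<open>v\<close> and \<open>a\<close> determines \<open>w\<close> and \<open>a\<close>:
  among the minima of \<open>K\<close> over the sets \<open>N\<^sup>+[x] - {v}\<close> with \<open>v \<in> N\<^sup>+[x]\<close>, the largest one is
  \<open>K a\<close>, and it is attained only for \<open>x = w\<close>.
\<close>

definition latest_minimum :: "('a \<Rightarrow> nat) \<Rightarrow> 'a \<Rightarrow> 'a \<Rightarrow> 'a \<Rightarrow> bool" where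
  "latest_minimum K v w a \<longleftrightarrow>
    w \<in> pverts G \<and> v \<in> closed_out_nbhd G w \<and> a \<in> closed_out_nbhd G w - {v} \<and>
    (\<forall>u\<in>closed_out_nbhd G w - {v}. K a \<le> K u) \<and>
    (\<forall>x\<in>pverts G - {w}. v \<in> closed_out_nbhd G x \<longrightarrow>
      (\<exists>u\<in>closed_out_nbhd G x - {v}. K u < K a))"

lemma latest_minimum_less:
  assumes "latest_minimum K v w a" "latest_minimum K v w' a'" "w \<noteq> w'"
  shows "K a' < K a"
proof -
  obtain u where "u \<in> closed_out_nbhd G w' - {v}" "K u < K a"
    using assms unfolding latest_minimum_def by blast
  moreover from this have "K a' \<le> K u"
    using assms(2) unfolding latest_minimum_def by blast
  ultimately show ?thesis
    by simp
qed

text \<open>Distinct \<open>w\<close> and \<open>w'\<close> would give strict inequalities both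
  ways; for equal ones, \<open>a\<close> and \<open>a'\<close> minimise the injective
  \<open>K\<close> over the same set.\<close>

lemma latest_minimum_unique:
  assumes "inj_on K (pverts G)" "latest_minimum K v w a" "latest_minimum K v w' a'"
  shows "a = a'"
proof -
  have "w = w'"
    using latest_minimum_less[OF assms(2,3)] latest_minimum_less[OF assms(3,2)] by fastforce
  then have "K a = K a'"
    using assms(2,3) unfolding latest_minimum_def by (blast intro: order_antisym)
  moreover have "a \<in> pverts G" "a' \<in> pverts G"
    using assms(2,3) closed_out_nbhd_subset unfolding latest_minimum_def by blast+
  ultimately show ?thesis
    using assms(1) by (auto dest: inj_onD)
qed

lemma exchange_labels:
  assumes L: "L \<in> labellings (pverts G)" and w: "represented L v = {w}"
    and nonempty: "out_nbhd G w \<noteq> {}"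
  shows "\<exists>a. latest_minimum (L \<circ> Transposition.transpose v a) v w a \<and>
    L \<circ> Transposition.transpose v a \<in> labellings (pverts G) \<and>
    represented (L \<circ> Transposition.transpose v a) v = {}"
proof -
  let ?S = "closed_out_nbhd G w - {v}"
  have wV: "w \<in> pverts G" and rep: "representative G L w = v"
    using w by (auto simp: represented_def)
  have v: "v \<in> closed_out_nbhd G w" and v_min: "\<forall>u\<in>closed_out_nbhd G w. L v \<le> L u"
    using rep representative_eq_iff[OF L wV] by auto
  have vV: "v \<in> pverts G"
    using v wV closed_out_nbhd_subset by blast
  have fin: "finite ?S"
    using finite_subset[OF closed_out_nbhd_subset[OF wV]] by simp
  \<comment> \<open>Without loops, \<open>w\<close> and an out-neighbour are two elements of the
    closed neighbourhood; at most one of them is \<open>v\<close>.\<close>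
  have ne: "?S \<noteq> {}"
  proof -
    obtain u where "(w, u) \<in> parcs G"
      using nonempty by (auto simp: out_nbhd_def)
    moreover from this have "u \<noteq> w"
      using no_loops' by blast
    ultimately show ?thesis
      by (auto simp: closed_out_nbhd_def out_nbhd_def)
  qed
  define a where "a = arg_min_on L ?S"
  have a: "a \<in> ?S" and a_min: "\<forall>u\<in>?S. L a \<le> L u"
    using arg_min_if_finite[OF fin ne, of L] by (auto simp: a_def not_less)
  have aV: "a \<in> pverts G"
    using a wV closed_out_nbhd_subset by blast
  have va: "L v < L a"
  proof -
    have "L v \<noteq> L a"
      using a vV aV labellings_inj_on[OF L] by (auto dest: inj_onD)
    then show ?thesis
      using a v_min by (simp add: order_less_le)
  qed
  define K where "K = L \<circ> Transposition.transpose v a"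
  have Kv: "K v = L a" and Ka: "K a = L v"
    and K: "\<And>u. u \<noteq> v \<Longrightarrow> u \<noteq> a \<Longrightarrow> K u = L u"
    by (auto simp: K_def Transposition.transpose_def)
  \<comment> \<open>After the exchange \<open>a\<close> carries \<open>L v\<close>, the least label
    in the neighbourhood of \<open>w\<close>.\<close>
  have 1: "K a \<le> K u" if "u \<in> ?S" for u
    using that v_min Ka K[of u] by (cases "u = a") auto
  \<comment> \<open>As \<open>v\<close> does not represent \<open>x\<close> under \<open>L\<close>,
    some \<open>u\<close> beats \<open>L v\<close>. It is neither \<open>v\<close> nor
    \<open>a\<close>, so it keeps its label, and \<open>K a = L v\<close>.\<close>
  have 2: "\<exists>u\<in>closed_out_nbhd G x - {v}. K u < K a"
    if x: "x \<in> pverts G" "x \<noteq> w" "v \<in> closed_out_nbhd G x" for x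
  proof -
    have "representative G L x \<noteq> v"
      using w x by (auto simp: represented_def)
    then obtain u where u: "u \<in> closed_out_nbhd G x" "L u < L v"
      using x representative_eq_iff[OF L, of x v] by (auto simp: not_le)
    then have "u \<noteq> v" "u \<noteq> a"
      using va by auto
    with u show ?thesis
      using K Ka by (intro bexI[of _ u]) auto
  qed
  have 3: "K \<in> labellings (pverts G)"
    unfolding K_def using labellings_comp_transpose[OF L vV aV] .
  \<comment> \<open>Now \<open>v\<close> carries \<open>L a\<close>, which exceeds
    \<open>K a\<close>, while every closed neighbourhood containing \<open>v\<close> has a label at
    most \<open>K a\<close>: for \<open>w\<close> it is that of \<open>a\<close>, otherwise fact 2
    applies.\<close>
  have "representative G K x \<noteq> v" if x: "x \<in> pverts G" for x
  proof
    assume "representative G K x = v"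
    then have vx: "v \<in> closed_out_nbhd G x" and min: "\<forall>u\<in>closed_out_nbhd G x. K v \<le> K u"
      using representative_eq_iff[OF 3 x] by auto
    have "\<exists>u\<in>closed_out_nbhd G x. K u \<le> K a"
    proof (cases "x = w")
      case True
      with a show ?thesis by blast
    next
      case False
      from 2[OF x this vx] show ?thesis
        by (auto intro: less_imp_le)
    qed
    with min va Kv Ka show False
      by fastforce
  qed
  then have "represented K v = {}"
    by (auto simp: represented_def)
  moreover have "latest_minimum K v w a"
    unfolding latest_minimum_def using wV v a 1 2 by blast
  ultimately show ?thesis
    using 3 unfolding K_def by blast
qed

lemma card_labellings_represented_singleton_le:
  assumes "\<forall>w\<in>pverts G. out_nbhd G w \<noteq> {}"
  shows "card {L \<in> labellings (pverts G). card (represented L v) = 1}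
    \<le> card {L \<in> labellings (pverts G). represented L v = {}}"
proof -
  let ?A = "{L \<in> labellings (pverts G). card (represented L v) = 1}"
  let ?B = "{L \<in> labellings (pverts G). represented L v = {}}"
  have "\<exists>a w. latest_minimum (L \<circ> Transposition.transpose v a) v w a \<and>
    L \<circ> Transposition.transpose v a \<in> ?B" if L: "L \<in> ?A" for L
  proof -
    obtain w where w: "represented L v = {w}"
      using L by (auto simp: card_1_singleton_iff)
    then have "out_nbhd G w \<noteq> {}"
      using assms by (auto simp: represented_def)
    with L w show ?thesis
      using exchange_labels[of L v w] by blast
  qed
  \<comment> \<open>Only \<open>a\<close> is chosen as a function of \<open>L\<close>;
    \<open>w\<close> can stay existential, since uniqueness of \<open>a\<close> holds across
    different \<open>w\<close>.\<close>
  then obtain a where "\<forall>L\<in>?A. \<exists>w. latest_minimum (L \<circ> Transposition.transpose v (a L)) v w (a L) \<and>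
    L \<circ> Transposition.transpose v (a L) \<in> ?B"
    using bchoice[of ?A "\<lambda>L a. \<exists>w. latest_minimum (L \<circ> Transposition.transpose v a) v w a \<and>
      L \<circ> Transposition.transpose v a \<in> ?B"] by blast
  then have a: "\<exists>w. latest_minimum (L \<circ> Transposition.transpose v (a L)) v w (a L)"
    "L \<circ> Transposition.transpose v (a L) \<in> ?B" if "L \<in> ?A" for L
    using that by blast+
  show ?thesis
  proof (rule card_inj_on_le)
    show "inj_on (\<lambda>L. L \<circ> Transposition.transpose v (a L)) ?A"
    proof (rule inj_onI)
      fix L M
      assume LM: "L \<in> ?A" "M \<in> ?A"
        and eq: "L \<circ> Transposition.transpose v (a L) = M \<circ> Transposition.transpose v (a M)"
      have "inj_on (L \<circ> Transposition.transpose v (a L)) (pverts G)"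
        using a(2)[OF LM(1)] labellings_inj_on by blast
      then have "a L = a M"
        using a(1)[OF LM(1)] a(1)[OF LM(2)] latest_minimum_unique unfolding eq by blast
      \<comment> \<open>With \<open>a L = a M\<close>, both labellings are recovered by the same
        involution.\<close>
      with eq have "L \<circ> Transposition.transpose v (a L) \<circ> Transposition.transpose v (a L)
        = M \<circ> Transposition.transpose v (a L) \<circ> Transposition.transpose v (a L)"
        by simp
      then show "L = M"
        by (simp add: comp_assoc)
    qed
    show "(\<lambda>L. L \<circ> Transposition.transpose v (a L)) ` ?A \<subseteq> ?B"
      using a(2) by blast
    show "finite ?B"
      by (simp add: finite_labellings)
  qed
qed

section \<open>The upper bound by double counting\<close>

lemma expected_representatives_le:
  assumes "\<forall>v\<in>pverts G. out_nbhd G v \<noteq> {}"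
  shows "expected_representatives G \<le> 2 / 3 * real (card (pverts G))"
proof -
  let ?V = "pverts G" and ?\<L> = "labellings (pverts G)"
  let ?n = "card ?V" and ?N = "card ?\<L>"
  let ?one = "\<lambda>L v. of_bool (card (represented L v) = 1) :: nat"
  let ?zero = "\<lambda>L v. of_bool (represented L v = {}) :: nat"
  let ?Z = "\<Sum>L\<in>?\<L>. \<Sum>v\<in>?V. ?zero L v"
  have fin: "finite ?\<L>"
    by (simp add: finite_labellings)
  have "finite (represented L v)" for L v
    by (simp add: represented_def)
  \<comment> \<open>Finiteness makes cardinality 0 mean emptiness. Equality holds for cardinalities
    0, 1 and 2.\<close>
  then have pointwise: "2 \<le> card (represented L v) + ?one L v + 2 * ?zero L v" for L v
    by (cases "card (represented L v)") auto
  \<comment> \<open>Summing over labellings first lets the injection be applied for each fixed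
    \<open>v\<close>.\<close>
  have one_le: "(\<Sum>L\<in>?\<L>. \<Sum>v\<in>?V. ?one L v) \<le> ?Z"
    unfolding sum.swap[of _ _ ?\<L>]
    by (rule sum_mono)
      (use card_labellings_represented_singleton_le[OF assms] in
        \<open>simp add: fin of_bool_def sum.If_cases Int_def\<close>)
  have "2 * ?n * ?N = (\<Sum>L\<in>?\<L>. \<Sum>v\<in>?V. 2)"
    by simp
  also have "\<dots> \<le> (\<Sum>L\<in>?\<L>. \<Sum>v\<in>?V. card (represented L v) + ?one L v + 2 * ?zero L v)"
    by (intro sum_mono pointwise)
  also have "\<dots> = ?n * ?N + (\<Sum>L\<in>?\<L>. \<Sum>v\<in>?V. ?one L v) + 2 * ?Z"
    by (simp add: sum.distrib sum_distrib_left[symmetric] sum_card_represented)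
  also have "\<dots> \<le> ?n * ?N + 3 * ?Z"
    using one_le by simp
  finally have "?n * ?N \<le> 3 * ?Z"
    by simp
  moreover have "(\<Sum>L\<in>?\<L>. card (representative G L ` ?V)) + ?Z = ?n * ?N"
  proof -
    have "(\<Sum>L\<in>?\<L>. card (representative G L ` ?V)) + ?Z
        = (\<Sum>L\<in>?\<L>. card (representative G L ` ?V) + card {v \<in> ?V. represented L v = {}})"
      by (simp add: sum.distrib of_bool_def sum.If_cases Int_def)
    then show ?thesis
      by (simp add: card_representatives)
  qed
  ultimately have "3 * (\<Sum>L\<in>?\<L>. card (representative G L ` ?V)) \<le> 2 * (?n * ?N)"
    by linarith
  then have "real (3 * (\<Sum>L\<in>?\<L>. card (representative G L ` ?V))) \<le> real (2 * (?n * ?N))"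
    by (simp only: of_nat_le_iff)
  moreover have "?N > 0"
    using fin by (simp add: card_gt_0_iff labellings_nonempty)
  ultimately show ?thesis
    by (simp add: expected_representatives_eq field_simps)
qed

end

section \<open>Tightness\<close>

lemma pair_digraph_directed_3_cycle: "pair_digraph directed_3_cycle"
  by unfold_locales (auto simp: directed_3_cycle_def)

text \<open>The closed neighbourhoods are the three pairs of vertices: the smallest label wins two
  of them, the middle one wins one, the largest none. The count is thus constant.\<close>

lemma card_representatives_directed_3_cycle:
  assumes "L \<in> labellings (pverts directed_3_cycle)"
  shows "card (representative directed_3_cycle L ` pverts directed_3_cycle) = 2"
proof -
  interpret pair_digraph directed_3_cycle
    by (rule pair_digraph_directed_3_cycle)
  have nbhd: "closed_out_nbhd directed_3_cycle 0 = {0, 1}"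
    "closed_out_nbhd directed_3_cycle 1 = {1, 2}" "closed_out_nbhd directed_3_cycle 2 = {2, 0}"
    by (auto simp: closed_out_nbhd_def out_nbhd_def directed_3_cycle_def)
  have V: "pverts directed_3_cycle = {0, 1, 2}"
    by (simp add: directed_3_cycle_def)
  have "L 0 \<noteq> L 1" "L 1 \<noteq> L 2" "L 2 \<noteq> L 0"
    using labellings_inj_on[OF assms] by (auto simp: V inj_on_def)
  moreover have "representative directed_3_cycle L 0 = (if L 0 \<le> L 1 then 0 else 1)"
    "representative directed_3_cycle L 1 = (if L 1 \<le> L 2 then 1 else 2)"
    "representative directed_3_cycle L 2 = (if L 2 \<le> L 0 then 2 else 0)"
    by (subst representative_eq_iff[OF assms]; simp add: nbhd V del: One_nat_def)+
  \<comment> \<open>The all-true and all-false cases would order the labels cyclically and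
    contradict distinctness.\<close>
  ultimately show ?thesis
    by (cases "L 0 \<le> L 1"; cases "L 1 \<le> L 2"; cases "L 2 \<le> L 0") (simp_all add: V card_insert_if)
qed

lemma expected_representatives_directed_3_cycle: "expected_representatives directed_3_cycle = 2"
proof -
  have "finite (pverts directed_3_cycle)"
    by (simp add: directed_3_cycle_def)
  then show ?thesis
    by (simp add: expected_representatives_eq card_representatives_directed_3_cycle
        card_labellings)
qed

theorem theorem2:
  shows "(\<forall>G :: 'a pair_pre_digraph.
            pair_digraph G \<and> (\<forall>v \<in> pverts G. out_nbhd G v \<noteq> {}) \<longrightarrow>
              expected_representatives G \<le> 2 / 3 * real (card (pverts G))) \<and>
         pair_digraph directed_3_cycle \<and>
         (\<forall>v \<in> pverts directed_3_cycle. out_nbhd directed_3_cycle v \<noteq> {}) \<and>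
         expected_representatives directed_3_cycle = 2 / 3 * real (card (pverts directed_3_cycle))"
proof (intro conjI allI impI)
  fix G :: "'a pair_pre_digraph"
  assume "pair_digraph G \<and> (\<forall>v \<in> pverts G. out_nbhd G v \<noteq> {})"
  then show "expected_representatives G \<le> 2 / 3 * real (card (pverts G))"
    using pair_digraph.expected_representatives_le by blast
next
  show "\<forall>v \<in> pverts directed_3_cycle. out_nbhd directed_3_cycle v \<noteq> {}"
    by (auto simp: directed_3_cycle_def out_nbhd_def)
  show "expected_representatives directed_3_cycle = 2 / 3 * real (card (pverts directed_3_cycle))"
    unfolding expected_representatives_directed_3_cycle by (simp add: directed_3_cycle_def)
qed (rule pair_digraph_directed_3_cycle)

end
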